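(* Let $G$ be a group equipped with a bi-invariant word metric $d$, with associated norm $\|g\|=d(g,1)$, and let $\omega$ be a non-principal ultrafilter on $\mathbb{N}$. Let $\operatorname{Cone}_\omega(G)$ be the asymptotic cone of $(G,d)$ and let $\eta\colon G\to\operatorname{Cone}_\omega(G)$ be defined by $\eta(g)=[g^n]$. If $F\colon\operatorname{Cone}_\omega(G)\to\mathbb{R}$ is a Lipschitz function (with respect to $d_\omega$) such that $F(1)=0$, then $F\circ\eta\colon G\to\mathbb{R}$ is a partial quasimorphism relative to $\|\cdot\|$.
   Context: A word metric on $G$ is $d(g,h)=\|gh^{-1}\|$, where $\|g\|=\min\{n\in\mathbb{N} : g=s_1\cdots s_n,\ s_i\in S\}$ (with $\|1\|=0$) for a symmetric generating set $S=S^{-1}$; it is bi-invariant (both left- and right-invariant) if and only if $g^{-1}Sg=S$ for all $g\in G$. An ultrafilter $\omega$ on $\mathbb{N}$ is viewed as a finitely additive measure $\omega\colon 2^{\mathbb{N}}\to\{0,1\}$; it is non-principal if every finite set has measure zero. For a bounded real sequence, $\lim_\omega a_n=a$ means that $\omega\{n : |a_n-a|<\varepsilon\}=1$ for every $\varepsilon>0$. (Sequences involving division by $n$ are indexed by $n\ge1$.) Asymptotic cone: let $\prod_0 G=\{(g_n)\in G^{\mathbb{N}} : \|g_n\|=O(n)\}$, a group under pointwise multiplication, with the degenerate norm $\|(g_n)\|_\omega=\lim_\omega\frac{\|g_n\|}{n}$. The elements with $\|(g_n)\|_\omega=0$ form a normal subgroup, and $\operatorname{Cone}_\omega(G)$ is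 the quotient group, with the induced norm $\|\cdot\|_\omega$ and metric $d_\omega(x,y)=\|xy^{-1}\|_\omega$; $[g_n]$ denotes the class of $(g_n)$. A function $F$ on a metric space $(X,\rho)$ is Lipschitz if there is $C>0$ with $|F(x)-F(y)|\le C\rho(x,y)$ for all $x,y\in X$. A function $f\colon G\to\mathbb{R}$ is a partial quasimorphism relative to $\|\cdot\|$ if there is $D\ge0$ with $|f(g)-f(gh)+f(h)|\le D\min\{\|g\|,\|h\|\}$ for all $g,h\in G$. *)

theory Defs
  imports "HOL-Algebra.Product_Groups" "HOL-Library.Landau_Symbols"
begin

section \<open>Word metrics\<close>

definition symmetric_generating_set :: "('a, 'b) monoid_scheme \<Rightarrow> 'a set \<Rightarrow> bool" where
  "symmetric_generating_set G S \<longleftrightarrow>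
     S \<subseteq> carrier G \<and> m_inv G ` S = S \<and> generate G S = carrier G"

definition word_norm :: "('a, 'b) monoid_scheme \<Rightarrow> 'a set \<Rightarrow> 'a \<Rightarrow> real" where
  "word_norm G S g =
     real (LEAST n. \<exists>ws. set ws \<subseteq> S \<and> length ws = n \<and> g = foldr (\<otimes>\<^bsub>G\<^esub>) ws \<one>\<^bsub>G\<^esub>)"

definition norm_dist :: "('a, 'b) monoid_scheme \<Rightarrow> ('a \<Rightarrow> real) \<Rightarrow> 'a \<Rightarrow> 'a \<Rightarrow> real" where
  "norm_dist G N g h = N (g \<otimes>\<^bsub>G\<^esub> inv\<^bsub>G\<^esub> h)"

definition bi_invariant :: "('a, 'b) monoid_scheme \<Rightarrow> ('a \<Rightarrow> 'a \<Rightarrow> real) \<Rightarrow> bool" where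
  "bi_invariant G d \<longleftrightarrow>
     (\<forall>g\<in>carrier G. \<forall>h\<in>carrier G. \<forall>k\<in>carrier G.
        d (k \<otimes>\<^bsub>G\<^esub> g) (k \<otimes>\<^bsub>G\<^esub> h) = d g h \<and> d (g \<otimes>\<^bsub>G\<^esub> k) (h \<otimes>\<^bsub>G\<^esub> k) = d g h)"


section \<open>Non-principal ultrafilters as finitely additive measures\<close>

definition ultrafilter_measure :: "(nat set \<Rightarrow> nat) \<Rightarrow> bool" where
  "ultrafilter_measure \<omega> \<longleftrightarrow>
     range \<omega> \<subseteq> {0, 1} \<and> \<omega> UNIV = 1 \<and>
     (\<forall>A B. A \<inter> B = {} \<longrightarrow> \<omega> (A \<union> B) = \<omega> A + \<omega> B)"

definition nonprincipal :: "(nat set \<Rightarrow> nat) \<Rightarrow> bool" where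
  "nonprincipal \<omega> \<longleftrightarrow> (\<forall>A. finite A \<longrightarrow> \<omega> A = 0)"

definition has_ultralimit :: "(nat set \<Rightarrow> nat) \<Rightarrow> (nat \<Rightarrow> real) \<Rightarrow> real \<Rightarrow> bool" where
  "has_ultralimit \<omega> a l \<longleftrightarrow> (\<forall>\<epsilon>>0. \<omega> {n. \<bar>a n - l\<bar> < \<epsilon>} = 1)"

text \<open>Meaningful for bounded sequences, which have exactly one limit.\<close>

definition ultralimit :: "(nat set \<Rightarrow> nat) \<Rightarrow> (nat \<Rightarrow> real) \<Rightarrow> real" where
  "ultralimit \<omega> a = (THE l. has_ultralimit \<omega> a l)"


section \<open>The asymptotic cone\<close>

text \<open>
  Sequences in \<open>G\<close> are indexed by \<open>n \<ge> 1\<close>, as elements of the product group over \<open>{1..}\<close>; at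
  index 0 they have the dummy value \<^const>\<open>undefined\<close>. Neither the growth condition nor the limit
  along a non-principal ultrafilter depends on that value.
\<close>

definition linear_growth_group ::
    "('a, 'b) monoid_scheme \<Rightarrow> ('a \<Rightarrow> real) \<Rightarrow> (nat \<Rightarrow> 'a) monoid" where
  "linear_growth_group G N =
     (product_group {1..} (\<lambda>_. G))
       \<lparr>carrier := {x \<in> carrier (product_group {1..} (\<lambda>_. G)). (\<lambda>n. N (x n)) \<in> O(\<lambda>n. real n)}\<rparr>"

definition seq_norm :: "('a \<Rightarrow> real) \<Rightarrow> (nat set \<Rightarrow> nat) \<Rightarrow> (nat \<Rightarrow> 'a) \<Rightarrow> real" where
  "seq_norm N \<omega> x = ultralimit \<omega> (\<lambda>n. N (x n) / real n)"

definition null_sequences ::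
    "('a, 'b) monoid_scheme \<Rightarrow> ('a \<Rightarrow> real) \<Rightarrow> (nat set \<Rightarrow> nat) \<Rightarrow> (nat \<Rightarrow> 'a) set" where
  "null_sequences G N \<omega> = {x \<in> carrier (linear_growth_group G N). seq_norm N \<omega> x = 0}"

definition asymptotic_cone ::
    "('a, 'b) monoid_scheme \<Rightarrow> ('a \<Rightarrow> real) \<Rightarrow> (nat set \<Rightarrow> nat) \<Rightarrow> (nat \<Rightarrow> 'a) set monoid" where
  "asymptotic_cone G N \<omega> = linear_growth_group G N Mod null_sequences G N \<omega>"

definition cone_class ::
    "('a, 'b) monoid_scheme \<Rightarrow> ('a \<Rightarrow> real) \<Rightarrow> (nat set \<Rightarrow> nat) \<Rightarrow> (nat \<Rightarrow> 'a) \<Rightarrow> (nat \<Rightarrow> 'a) set" where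
  "cone_class G N \<omega> x = null_sequences G N \<omega> #>\<^bsub>linear_growth_group G N\<^esub> restrict x {1..}"

text \<open>All representatives of a class have the same norm, so the image below is a singleton.\<close>

definition cone_norm :: "('a \<Rightarrow> real) \<Rightarrow> (nat set \<Rightarrow> nat) \<Rightarrow> (nat \<Rightarrow> 'a) set \<Rightarrow> real" where
  "cone_norm N \<omega> K = the_elem (seq_norm N \<omega> ` K)"

definition cone_dist ::
    "('a, 'b) monoid_scheme \<Rightarrow> ('a \<Rightarrow> real) \<Rightarrow> (nat set \<Rightarrow> nat)
      \<Rightarrow> (nat \<Rightarrow> 'a) set \<Rightarrow> (nat \<Rightarrow> 'a) set \<Rightarrow> real" where
  "cone_dist G N \<omega> = norm_dist (asymptotic_cone G N \<omega>) (cone_norm N \<omega>)"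

definition cone_eta ::
    "('a, 'b) monoid_scheme \<Rightarrow> ('a \<Rightarrow> real) \<Rightarrow> (nat set \<Rightarrow> nat) \<Rightarrow> 'a \<Rightarrow> (nat \<Rightarrow> 'a) set" where
  "cone_eta G N \<omega> g = cone_class G N \<omega> (\<lambda>n. g [^]\<^bsub>G\<^esub> n)"


section \<open>Lipschitz functions and partial quasimorphisms\<close>

text \<open>
  The distance is a function on a carrier set with no control outside it, so the library notions
  for the class \<open>metric_space\<close> and for the type \<open>metric\<close> do not apply directly.
\<close>

definition Lipschitz_fun :: "'x set \<Rightarrow> ('x \<Rightarrow> 'x \<Rightarrow> real) \<Rightarrow> ('x \<Rightarrow> real) \<Rightarrow> bool" where
  "Lipschitz_fun M \<rho> F \<longleftrightarrow> (\<exists>C>0. \<forall>x\<in>M. \<forall>y\<in>M. \<bar>F x - F y\<bar> \<le> C * \<rho> x y)"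

definition partial_quasimorphism ::
    "('a, 'b) monoid_scheme \<Rightarrow> ('a \<Rightarrow> real) \<Rightarrow> ('a \<Rightarrow> real) \<Rightarrow> bool" where
  "partial_quasimorphism G N f \<longleftrightarrow>
     (\<exists>D\<ge>0. \<forall>g\<in>carrier G. \<forall>h\<in>carrier G.
        \<bar>f g - f (g \<otimes>\<^bsub>G\<^esub> h) + f h\<bar> \<le> D * min (N g) (N h))"

end

theory Submission
  imports Defs "HOL-Analysis.Elementary_Topology"
begin

text \<open>
  The heart of the matter is an estimate in \<open>G\<close> itself. For a bi-invariant metric \<open>d\<close>, changing one
  factor of a product moves the product exactly as far as that factor moves; changing all the
  factors of \<open>g\<^sup>n\<close> into those of \<open>h\<^sup>n\<close>, one at a time, gives \<open>d (g\<^sup>n) (h\<^sup>n) \<le> n * d g h\<close>.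
  After division by \<open>n\<close> and passage to the limit this says that \<open>\<eta>\<close> is 1-Lipschitz, although it is
  in general not a homomorphism. Now \<open>d g (g h) = \<parallel>h\<parallel>\<close> and \<open>d h (g h) = \<parallel>g\<parallel>\<close>. With \<open>f = F \<circ> \<eta>\<close> and
  \<open>F\<close> being \<open>C\<close>-Lipschitz, both \<open>f g - f (g h)\<close> and \<open>f h = f h - f 1\<close> are at most \<open>C \<parallel>h\<parallel>\<close> in absolute
  value, and in the same way \<open>f h - f (g h)\<close> and \<open>f g\<close> are at most \<open>C \<parallel>g\<parallel>\<close>. Hence the defect
  \<open>f g - f (g h) + f h\<close> is at most \<open>2 C min \<parallel>g\<parallel> \<parallel>h\<parallel>\<close>.

  The estimate needs of the word norm only that it vanishes at the identity and is symmetric,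
  subadditive and conjugation invariant. These properties pass to the degenerate norm on sequences of linear growth,
  because limits along an ultrafilter respect sums and inequalities. They also imply that
  the elements of norm zero form a normal subgroup on whose cosets the norm is constant, so the same
  abstract notion serves both \<open>G\<close> and the group of sequences from which the cone is formed.
\<close>

section \<open>Conjugation-invariant norms on groups\<close>

locale invariant_norm = group G for G (structure) +
  fixes N :: "'a \<Rightarrow> real"
  assumes norm_one: "N \<one> = 0"
    and norm_inv: "x \<in> carrier G \<Longrightarrow> N (inv x) = N x"
    and norm_mult_le: "x \<in> carrier G \<Longrightarrow> y \<in> carrier G \<Longrightarrow> N (x \<otimes> y) \<le> N x + N y"
    and norm_conj: "x \<in> carrier G \<Longrightarrow> y \<in> carrier G \<Longrightarrow> N (x \<otimes> y \<otimes> inv x) = N y"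
begin

lemma norm_nonneg:
  assumes "x \<in> carrier G"
  shows "0 \<le> N x"
  using norm_mult_le[of x "inv x"] assms by (simp add: norm_one norm_inv)

lemma norm_mult_null_left:
  assumes "k \<in> carrier G" "N k = 0" "x \<in> carrier G"
  shows "N (k \<otimes> x) = N x"
proof (rule antisym)
  show "N (k \<otimes> x) \<le> N x"
    using norm_mult_le[of k x] assms by simp
  have "N (inv k \<otimes> (k \<otimes> x)) \<le> N (inv k) + N (k \<otimes> x)"
    using assms by (intro norm_mult_le) auto
  then show "N x \<le> N (k \<otimes> x)"
    using assms by (simp add: norm_inv m_assoc[symmetric])
qed

lemma null_elements_normal: "{x \<in> carrier G. N x = 0} \<lhd> G"
proof (rule normal_invI)
  show "subgroup {x \<in> carrier G. N x = 0} G"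
    by (rule subgroupI) (auto simp: norm_inv norm_one norm_mult_null_left)
next
  fix x h
  assume "x \<in> carrier G" "h \<in> {x \<in> carrier G. N x = 0}"
  then show "x \<otimes> h \<otimes> inv x \<in> {x \<in> carrier G. N x = 0}"
    by (auto simp: norm_conj)
qed

text \<open>
  In the quotient by the elements of norm zero the norm of a coset is read off from the image of
  the coset under \<open>N\<close>, so this image has to be a single value.
\<close>

lemma norm_image_null_coset:
  assumes "x \<in> carrier G"
  shows "N ` ({x \<in> carrier G. N x = 0} #> x) = {N x}"
proof -
  have "N y = N x" if "y \<in> {x \<in> carrier G. N x = 0} #> x" for y
    using that assms by (auto simp: r_coset_def norm_mult_null_left)
  moreover have "x \<in> {x \<in> carrier G. N x = 0} #> x"
    using assms norm_one by (auto simp: r_coset_def intro!: exI[of _ \<one>])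
  ultimately show ?thesis by blast
qed

text \<open>
  The difference factors as \<open>x (y u\<^sup>-\<^sup>1) x\<^sup>-\<^sup>1 \<cdot> x z\<^sup>-\<^sup>1\<close>, and conjugating the first factor back does not
  change its norm. This is where both left and right invariance enter.
\<close>

lemma norm_dist_mult_le:
  assumes "x \<in> carrier G" "y \<in> carrier G" "z \<in> carrier G" "u \<in> carrier G"
  shows "N (x \<otimes> y \<otimes> inv (z \<otimes> u)) \<le> N (x \<otimes> inv z) + N (y \<otimes> inv u)"
proof -
  have "inv x \<otimes> (x \<otimes> inv z) = inv z"
    using assms by (simp add: m_assoc[symmetric])
  then have "x \<otimes> y \<otimes> inv (z \<otimes> u) = (x \<otimes> (y \<otimes> inv u) \<otimes> inv x) \<otimes> (x \<otimes> inv z)"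
    using assms by (simp add: inv_mult_group m_assoc)
  then have "N (x \<otimes> y \<otimes> inv (z \<otimes> u))
      \<le> N (x \<otimes> (y \<otimes> inv u) \<otimes> inv x) + N (x \<otimes> inv z)"
    using assms by (simp add: norm_mult_le)
  then show ?thesis
    using assms by (simp add: norm_conj)
qed

text \<open>
  Passing from \<open>n\<close> to \<open>Suc n\<close> appends one factor on each side, at a cost of \<open>N (g h\<^sup>-\<^sup>1)\<close>. Invariance
  keeps this cost the same at every step, whatever the \<open>n\<close> factors in front of it are.
\<close>

lemma norm_dist_pow_le:
  assumes "g \<in> carrier G" "h \<in> carrier G"
  shows "N (g [^] (n::nat) \<otimes> inv (h [^] n)) \<le> real n * N (g \<otimes> inv h)"
proof (induction n)
  case 0
  then show ?case by (simp add: norm_one)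
next
  case (Suc n)
  have "N (g [^] n \<otimes> g \<otimes> inv (h [^] n \<otimes> h)) \<le> N (g [^] n \<otimes> inv (h [^] n)) + N (g \<otimes> inv h)"
    using assms by (intro norm_dist_mult_le) auto
  with Suc show ?case by (simp add: algebra_simps)
qed

lemma norm_dist_mult_right:
  assumes "g \<in> carrier G" "h \<in> carrier G"
  shows "N (g \<otimes> inv (g \<otimes> h)) = N h"
proof -
  have "g \<otimes> inv (g \<otimes> h) = g \<otimes> inv h \<otimes> inv g"
    using assms by (simp add: inv_mult_group m_assoc)
  then show ?thesis
    using assms by (simp add: norm_conj norm_inv)
qed

lemma norm_dist_mult_left:
  assumes "g \<in> carrier G" "h \<in> carrier G"
  shows "N (h \<otimes> inv (g \<otimes> h)) = N g"
proof -
  have "h \<otimes> inv (g \<otimes> h) = inv g"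
    using assms by (simp add: inv_mult_group m_assoc[symmetric])
  then show ?thesis
    using assms by (simp add: norm_inv)
qed

end


section \<open>Word norms\<close>

context group
begin

lemma foldr_mult_closed:
  "set ws \<subseteq> carrier G \<Longrightarrow> foldr (\<otimes>) ws \<one> \<in> carrier G"
  by (induction ws) auto

lemma foldr_mult_append:
  assumes "set us \<subseteq> carrier G" "set vs \<subseteq> carrier G"
  shows "foldr (\<otimes>) (us @ vs) \<one> = foldr (\<otimes>) us \<one> \<otimes> foldr (\<otimes>) vs \<one>"
  using assms by (induction us) (auto simp: foldr_mult_closed m_assoc simp del: foldr_append)

text \<open>
  The reversed word of inverses has the same length and, for a symmetric alphabet, the same
  alphabet; this makes the word norm symmetric.
\<close>

lemma inv_foldr_mult:
  "set ws \<subseteq> carrier G \<Longrightarrow>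
    inv (foldr (\<otimes>) ws \<one>) = foldr (\<otimes>) (rev (map (m_inv G) ws)) \<one>"
proof (induction ws)
  case (Cons w ws)
  have "foldr (\<otimes>) (rev (map (m_inv G) ws) @ [inv w]) \<one> =
      foldr (\<otimes>) (rev (map (m_inv G) ws)) \<one> \<otimes> foldr (\<otimes>) [inv w] \<one>"
    using Cons.prems by (intro foldr_mult_append) auto
  with Cons show ?case
    by (simp add: inv_mult_group foldr_mult_closed del: foldr_append)
qed simp

lemma word_norm_foldr_le:
  assumes "set ws \<subseteq> S"
  shows "word_norm G S (foldr (\<otimes>) ws \<one>) \<le> real (length ws)"
  unfolding word_norm_def using assms by (intro of_nat_mono Least_le) auto

context
  fixes S
  assumes S: "symmetric_generating_set G S"
begin

lemma S_subset: "S \<subseteq> carrier G"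
  using S by (simp add: symmetric_generating_set_def)

lemma inv_in_S: "s \<in> S \<Longrightarrow> inv s \<in> S"
  using S by (auto simp: symmetric_generating_set_def)

lemma exists_word:
  assumes "g \<in> carrier G"
  shows "\<exists>ws. set ws \<subseteq> S \<and> g = foldr (\<otimes>) ws \<one>"
proof -
  have "g \<in> generate G S"
    using S assms by (simp add: symmetric_generating_set_def)
  then show ?thesis
  proof induction
    case one
    show ?case by (intro exI[of _ "[]"]) simp
  next
    case (incl h)
    then show ?case using S_subset by (intro exI[of _ "[h]"]) auto
  next
    case (inv h)
    then show ?case using S_subset inv_in_S by (intro exI[of _ "[inv h]"]) auto
  next
    case (eng h1 h2)
    then obtain us vs where "set us \<subseteq> S" "h1 = foldr (\<otimes>) us \<one>" "set vs \<subseteq> S" "h2 = foldr (\<otimes>) vs \<one>"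
      by blast
    then show ?case
      using S_subset by (intro exI[of _ "us @ vs"]) (auto simp: foldr_mult_append simp del: foldr_append)
  qed
qed

lemma shortest_word:
  assumes "g \<in> carrier G"
  obtains ws where "set ws \<subseteq> S" "g = foldr (\<otimes>) ws \<one>" "word_norm G S g = real (length ws)"
proof -
  have "\<exists>n ws. set ws \<subseteq> S \<and> length ws = n \<and> g = foldr (\<otimes>) ws \<one>"
    using exists_word[OF assms] by blast
  from LeastI_ex[OF this] show thesis
    using that unfolding word_norm_def by auto
qed

lemma word_norm_inv_le:
  assumes "g \<in> carrier G"
  shows "word_norm G S (inv g) \<le> word_norm G S g"
proof -
  obtain ws where ws: "set ws \<subseteq> S" "g = foldr (\<otimes>) ws \<one>" "word_norm G S g = real (length ws)"
    using shortest_word[OF assms] .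
  have "set (rev (map (m_inv G) ws)) \<subseteq> S"
    using ws inv_in_S by auto
  from word_norm_foldr_le[OF this] show ?thesis
    using ws S_subset inv_foldr_mult[of ws] by auto
qed

lemma word_norm_mult_le:
  assumes "g \<in> carrier G" "h \<in> carrier G"
  shows "word_norm G S (g \<otimes> h) \<le> word_norm G S g + word_norm G S h"
proof -
  obtain us where us: "set us \<subseteq> S" "g = foldr (\<otimes>) us \<one>" "word_norm G S g = real (length us)"
    using shortest_word[OF assms(1)] .
  obtain vs where vs: "set vs \<subseteq> S" "h = foldr (\<otimes>) vs \<one>" "word_norm G S h = real (length vs)"
    using shortest_word[OF assms(2)] .
  have "g \<otimes> h = foldr (\<otimes>) (us @ vs) \<one>"
    using us vs S_subset by (subst foldr_mult_append) auto
  then show ?thesis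
    using word_norm_foldr_le[of "us @ vs" S] us vs by simp
qed

lemma word_norm_invariant_norm:
  assumes "bi_invariant G (norm_dist G (word_norm G S))"
  shows "invariant_norm G (word_norm G S)"
proof
  show "word_norm G S \<one> = 0"
    using word_norm_foldr_le[of "[]" S] by (simp add: word_norm_def)
next
  fix x
  assume x: "x \<in> carrier G"
  show "word_norm G S (inv x) = word_norm G S x"
    using word_norm_inv_le[of x] word_norm_inv_le[of "inv x"] x by simp
next
  fix x y
  assume xy: "x \<in> carrier G" "y \<in> carrier G"
  then show "word_norm G S (x \<otimes> y) \<le> word_norm G S x + word_norm G S y"
    by (rule word_norm_mult_le)
  (* Left translation by x carries the pair y, 1 to the pair x y, x. *)
  have "norm_dist G (word_norm G S) (x \<otimes> y) (x \<otimes> \<one>) = norm_dist G (word_norm G S) y \<one>"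
    using assms xy unfolding bi_invariant_def by blast
  then show "word_norm G S (x \<otimes> y \<otimes> inv x) = word_norm G S y"
    using xy by (simp add: norm_dist_def)
qed

end

end


section \<open>Limits along an ultrafilter\<close>

text \<open>
  Turning the measure into a filter makes ultralimits ordinary limits, to which the limit laws
  of the library apply.
\<close>

definition measure_one_filter :: "(nat set \<Rightarrow> nat) \<Rightarrow> nat filter" where
  "measure_one_filter \<omega> = Abs_filter (\<lambda>P. \<omega> {n. P n} = 1)"

locale nonprincipal_ultrafilter =
  fixes \<omega> :: "nat set \<Rightarrow> nat"
  assumes ultra: "ultrafilter_measure \<omega>" and nonprinc: "nonprincipal \<omega>"
begin

lemma measure_cases: "\<omega> A = 0 \<or> \<omega> A = 1"
  using ultra unfolding ultrafilter_measure_def by blast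

lemma measure_Un: "A \<inter> B = {} \<Longrightarrow> \<omega> (A \<union> B) = \<omega> A + \<omega> B"
  using ultra unfolding ultrafilter_measure_def by blast

lemma measure_UNIV: "\<omega> UNIV = 1"
  using ultra unfolding ultrafilter_measure_def by blast

lemma measure_mono: "A \<subseteq> B \<Longrightarrow> \<omega> A \<le> \<omega> B"
  using measure_Un[of A "B - A"] by (simp add: Un_absorb1)

lemma measure_Compl: "\<omega> A + \<omega> (- A) = 1"
  using measure_Un[of A "- A"] measure_UNIV by simp

lemma measure_Int:
  assumes "\<omega> A = 1" "\<omega> B = 1"
  shows "\<omega> (A \<inter> B) = 1"
proof -
  have "\<omega> (A - B) \<le> \<omega> (- B)"
    by (rule measure_mono) auto
  then have "\<omega> (A - B) = 0"
    using measure_Compl[of B] assms by simp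
  moreover have "\<omega> A = \<omega> (A \<inter> B) + \<omega> (A - B)"
    using measure_Un[of "A \<inter> B" "A - B"] by (simp add: Int_Diff_Un Int_Diff_disjoint)
  ultimately show ?thesis using assms by simp
qed

lemma eventually_measure_one_filter:
  "eventually P (measure_one_filter \<omega>) \<longleftrightarrow> \<omega> {n. P n} = 1"
  unfolding measure_one_filter_def
proof (rule eventually_Abs_filter, rule is_filter.intro)
  show "\<omega> {n. True} = 1" using measure_UNIV by simp
next
  fix P Q
  assume "\<omega> {n. P n} = 1" "\<omega> {n. Q n} = 1"
  then show "\<omega> {n. P n \<and> Q n} = 1"
    using measure_Int by (simp add: Collect_conj_eq)
next
  fix P Q :: "nat \<Rightarrow> bool"
  assume "\<forall>n. P n \<longrightarrow> Q n" "\<omega> {n. P n} = 1"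
  then show "\<omega> {n. Q n} = 1"
    using measure_mono[of "{n. P n}" "{n. Q n}"] measure_cases[of "{n. Q n}"]
    by (simp add: Collect_mono)
qed

lemma measure_one_filter_neq_bot: "measure_one_filter \<omega> \<noteq> bot"
proof
  assume "measure_one_filter \<omega> = bot"
  then have "\<omega> {} = 1"
    using eventually_measure_one_filter[of "\<lambda>_. False"] by simp
  then show False
    using nonprinc unfolding nonprincipal_def by simp
qed

lemma measure_one_filter_dichotomy:
  "eventually P (measure_one_filter \<omega>) \<or> eventually (\<lambda>n. \<not> P n) (measure_one_filter \<omega>)"
  using measure_cases[of "{n. P n}"] measure_Compl[of "{n. P n}"]
  by (auto simp: eventually_measure_one_filter simp flip: Collect_neg_eq)

lemma measure_one_filter_le_sequentially: "measure_one_filter \<omega> \<le> sequentially"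
proof (rule filter_leI)
  fix P :: "nat \<Rightarrow> bool"
  assume "eventually P sequentially"
  then have "finite (- {n. P n})"
    unfolding cofinite_eq_sequentially[symmetric] eventually_cofinite by (simp add: Collect_neg_eq)
  then have "\<omega> (- {n. P n}) = 0"
    using nonprinc unfolding nonprincipal_def by simp
  then show "eventually P (measure_one_filter \<omega>)"
    using measure_Compl[of "{n. P n}"] by (simp add: eventually_measure_one_filter)
qed

lemma has_ultralimit_iff_tendsto:
  "has_ultralimit \<omega> a l \<longleftrightarrow> (a \<longlongrightarrow> l) (measure_one_filter \<omega>)"
  by (simp add: has_ultralimit_def tendsto_iff eventually_measure_one_filter dist_real_def)

lemma ultralimit_eqI:
  assumes "(a \<longlongrightarrow> l) (measure_one_filter \<omega>)"
  shows "ultralimit \<omega> a = l"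
  unfolding ultralimit_def has_ultralimit_iff_tendsto
  using assms tendsto_unique[OF measure_one_filter_neq_bot] by (intro the_equality) auto

text \<open>
  By compactness of an interval containing the sequence, some \<open>l\<close> is a cluster point along the
  filter. An ultrafilter converges to each of its cluster points: every neighbourhood is visited
  either almost always or almost never, and the latter contradicts clustering.
\<close>

lemma tendsto_ultralimit:
  assumes "eventually (\<lambda>n. \<bar>a n\<bar> \<le> c) (measure_one_filter \<omega>)"
  shows "(a \<longlongrightarrow> ultralimit \<omega> a) (measure_one_filter \<omega>)"
proof -
  let ?U = "measure_one_filter \<omega>"
  have "filtermap a ?U \<noteq> bot"
    using measure_one_filter_neq_bot by (simp add: filtermap_bot_iff)
  moreover have "eventually (\<lambda>x. x \<in> {-c..c}) (filtermap a ?U)"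
    unfolding eventually_filtermap using assms by eventually_elim auto
  ultimately obtain l where l: "inf (nhds l) (filtermap a ?U) \<noteq> bot"
    using compact_Icc[of "-c" c] unfolding compact_filter by blast
  have "(a \<longlongrightarrow> l) ?U"
  proof (rule topological_tendstoI)
    fix V
    assume V: "open V" "l \<in> V"
    show "eventually (\<lambda>n. a n \<in> V) ?U"
    proof (rule ccontr)
      assume "\<not> eventually (\<lambda>n. a n \<in> V) ?U"
      then have "eventually (\<lambda>x. x \<notin> V) (filtermap a ?U)"
        using measure_one_filter_dichotomy unfolding eventually_filtermap by blast
      moreover have "eventually (\<lambda>x. x \<in> V) (nhds l)"
        using V by (rule eventually_nhds_in_open)
      ultimately have "eventually (\<lambda>x. False) (inf (nhds l) (filtermap a ?U))"
        unfolding eventually_inf by blast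
      with l show False
        by (simp add: eventually_False)
    qed
  qed
  then show ?thesis
    using ultralimit_eqI by blast
qed

end


section \<open>Sequences of linear growth\<close>

context invariant_norm
begin

lemma carrier_linear_growth_group:
  "x \<in> carrier (linear_growth_group G N) \<longleftrightarrow>
    x \<in> carrier (product_group {1..} (\<lambda>_. G)) \<and> (\<lambda>n. N (x n)) \<in> O(\<lambda>n. real n)"
  by (simp add: linear_growth_group_def)

lemma linear_growth_nth_closed:
  "x \<in> carrier (linear_growth_group G N) \<Longrightarrow> 1 \<le> n \<Longrightarrow> x n \<in> carrier G"
  unfolding carrier_linear_growth_group carrier_product_group by (auto dest: PiE_mem)

lemma subgroup_linear_growth:
  "subgroup (carrier (linear_growth_group G N)) (product_group {1..} (\<lambda>_. G))"
  (is "subgroup ?L ?P")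
proof -
  interpret P: group ?P
    by (rule product_group) (rule is_group)
  show ?thesis
  proof (rule P.subgroupI)
    show "?L \<subseteq> carrier ?P"
      by (auto simp: carrier_linear_growth_group)
  next
    have "(\<lambda>n. N (\<one>\<^bsub>?P\<^esub> n)) \<in> O(\<lambda>n. real n)"
      by (intro bigoI[of _ 0] eventually_mono[OF eventually_ge_at_top[of 1]])
        (auto simp: norm_one)
    then have "\<one>\<^bsub>?P\<^esub> \<in> ?L"
      unfolding carrier_linear_growth_group using P.one_closed by blast
    then show "?L \<noteq> {}" by blast
  next
    fix x
    assume x: "x \<in> ?L"
    have "eventually (\<lambda>n. N ((inv\<^bsub>?P\<^esub> x) n) = N (x n)) sequentially"
      using eventually_ge_at_top[of 1]
    proof eventually_elim
      case (elim n)
      have "x \<in> (\<Pi>\<^sub>E i\<in>{1..}. carrier G)"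
        using x by (simp add: carrier_linear_growth_group)
      then show ?case
        using elim linear_growth_nth_closed[OF x elim] by (simp add: inv_product_group is_group norm_inv)
    qed
    then have "(\<lambda>n. N ((inv\<^bsub>?P\<^esub> x) n)) \<in> O(\<lambda>n. real n)"
      using x by (simp add: carrier_linear_growth_group landau_o.big.in_cong)
    then show "inv\<^bsub>?P\<^esub> x \<in> ?L"
      using x P.inv_closed unfolding carrier_linear_growth_group by blast
  next
    fix x y
    assume xy: "x \<in> ?L" "y \<in> ?L"
    have "eventually (\<lambda>n. norm (N ((x \<otimes>\<^bsub>?P\<^esub> y) n)) \<le> 1 * norm (N (x n) + N (y n))) sequentially"
      using eventually_ge_at_top[of 1]
    proof eventually_elim
      case (elim n)
      then have "x n \<in> carrier G" "y n \<in> carrier G"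
        using xy linear_growth_nth_closed by auto
      then show ?case
        using elim norm_mult_le[of "x n" "y n"] norm_nonneg by simp
    qed
    then have "(\<lambda>n. N ((x \<otimes>\<^bsub>?P\<^esub> y) n)) \<in> O(\<lambda>n. N (x n) + N (y n))"
      by (rule bigoI)
    also have "(\<lambda>n. N (x n) + N (y n)) \<in> O(\<lambda>n. real n)"
      using xy by (intro sum_in_bigo) (auto simp: carrier_linear_growth_group)
    finally show "x \<otimes>\<^bsub>?P\<^esub> y \<in> ?L"
      using xy P.m_closed unfolding carrier_linear_growth_group by blast
  qed
qed

lemma group_linear_growth_group: "group (linear_growth_group G N)"
proof -
  have "linear_growth_group G N =
      product_group {1..} (\<lambda>_. G) \<lparr>carrier := carrier (linear_growth_group G N)\<rparr>"
    by (simp add: linear_growth_group_def)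
  then show ?thesis
    using subgroup.subgroup_is_group[OF subgroup_linear_growth product_group]
    by (metis is_group)
qed

lemma linear_growth_one_nth: "1 \<le> n \<Longrightarrow> \<one>\<^bsub>linear_growth_group G N\<^esub> n = \<one>"
  by (simp add: linear_growth_group_def)

lemma power_sequence_one: "(\<lambda>n\<in>{1..}. \<one> [^] (n::nat)) = \<one>\<^bsub>linear_growth_group G N\<^esub>"
  by (simp add: linear_growth_group_def)

lemma linear_growth_mult_nth:
  "1 \<le> n \<Longrightarrow> (x \<otimes>\<^bsub>linear_growth_group G N\<^esub> y) n = x n \<otimes> y n"
  by (simp add: linear_growth_group_def)

lemma linear_growth_inv_nth:
  assumes x: "x \<in> carrier (linear_growth_group G N)" and n: "1 \<le> n"
  shows "(inv\<^bsub>linear_growth_group G N\<^esub> x) n = inv (x n)"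
proof -
  interpret L: group "linear_growth_group G N"
    by (rule group_linear_growth_group)
  have "(inv\<^bsub>linear_growth_group G N\<^esub> x \<otimes>\<^bsub>linear_growth_group G N\<^esub> x) n = \<one>"
    using x n linear_growth_one_nth[OF n] by simp
  then show ?thesis
    using x n linear_growth_nth_closed[OF x n] linear_growth_nth_closed[OF L.inv_closed[OF x] n]
    by (intro inv_equality[symmetric]) (simp_all only: linear_growth_mult_nth)
qed

lemma norm_pow_le:
  assumes "g \<in> carrier G"
  shows "N (g [^] (n::nat)) \<le> real n * N g"
  using norm_dist_pow_le[OF assms one_closed, of n] assms by simp

lemma power_sequence_linear_growth:
  assumes "g \<in> carrier G"
  shows "(\<lambda>n\<in>{1..}. g [^] (n::nat)) \<in> carrier (linear_growth_group G N)"
proof -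
  have "(\<lambda>n. N ((\<lambda>n\<in>{1..}. g [^] (n::nat)) n)) \<in> O(\<lambda>n. real n)"
  proof (rule bigoI[of _ "N g"], rule eventually_mono[OF eventually_ge_at_top[of 1]])
    fix n :: nat
    assume "1 \<le> n"
    then show "norm (N ((\<lambda>n\<in>{1..}. g [^] (n::nat)) n)) \<le> N g * norm (real n)"
      using norm_pow_le[OF assms, of n] norm_nonneg[of "g [^] n"] assms by (simp add: mult.commute)
  qed
  then show ?thesis
    using assms by (simp add: carrier_linear_growth_group)
qed

end


section \<open>The norm on the asymptotic cone\<close>

locale invariant_norm_ultrafilter = invariant_norm G N + nonprincipal_ultrafilter \<omega>
  for G (structure) and N and \<omega>
begin

abbreviation L where "L \<equiv> linear_growth_group G N"
abbreviation U where "U \<equiv> measure_one_filter \<omega>"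
abbreviation snorm where "snorm \<equiv> seq_norm N \<omega>"
abbreviation cone where "cone \<equiv> asymptotic_cone G N \<omega>"

lemma eventually_U_ge_1: "eventually (\<lambda>n. 1 \<le> n) U"
  by (rule filter_leD[OF measure_one_filter_le_sequentially eventually_ge_at_top])

lemma tendsto_seq_norm:
  assumes x: "x \<in> carrier L"
  shows "((\<lambda>n. N (x n) / real n) \<longlongrightarrow> snorm x) U"
proof -
  obtain c where "eventually (\<lambda>n. norm (N (x n)) \<le> c * norm (real n)) sequentially"
    using x unfolding carrier_linear_growth_group by (blast elim: landau_o.bigE)
  then have "eventually (\<lambda>n. norm (N (x n)) \<le> c * norm (real n)) U"
    by (rule filter_leD[OF measure_one_filter_le_sequentially])
  with eventually_U_ge_1 have "eventually (\<lambda>n. \<bar>N (x n) / real n\<bar> \<le> c) U"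
    by eventually_elim (simp add: abs_divide divide_le_eq)
  then show ?thesis
    unfolding seq_norm_def by (rule tendsto_ultralimit)
qed

lemma seq_norm_eq_if_norms_eq:
  assumes "y \<in> carrier L" "\<And>n. 1 \<le> n \<Longrightarrow> N (x n) = N (y n)"
  shows "snorm x = snorm y"
proof -
  have "eventually (\<lambda>n. N (y n) / real n = N (x n) / real n) U"
    using eventually_U_ge_1 by eventually_elim (simp add: assms)
  from Lim_transform_eventually[OF tendsto_seq_norm[OF assms(1)] this]
  show ?thesis
    unfolding seq_norm_def[of N \<omega> x] by (rule ultralimit_eqI)
qed

lemma seq_norm_le:
  assumes "x \<in> carrier L" "\<And>n. 1 \<le> n \<Longrightarrow> N (x n) \<le> real n * c"
  shows "snorm x \<le> c"
proof (rule tendsto_upperbound[OF tendsto_seq_norm[OF assms(1)] _ measure_one_filter_neq_bot])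
  show "eventually (\<lambda>n. N (x n) / real n \<le> c) U"
    using eventually_U_ge_1
    by eventually_elim (use assms(2) in \<open>simp add: divide_le_eq mult.commute\<close>)
qed

lemma seq_norm_invariant_norm: "invariant_norm L snorm"
proof -
  interpret L: group L
    by (rule group_linear_growth_group)
  show ?thesis
  proof
    show "snorm \<one>\<^bsub>L\<^esub> = 0"
    proof (rule antisym)
      show "snorm \<one>\<^bsub>L\<^esub> \<le> 0"
        by (rule seq_norm_le) (auto simp: linear_growth_one_nth norm_one)
      have "eventually (\<lambda>n. 0 \<le> N (\<one>\<^bsub>L\<^esub> n) / real n) U"
        using eventually_U_ge_1 by eventually_elim (simp add: linear_growth_one_nth norm_one)
      from tendsto_lowerbound[OF tendsto_seq_norm this measure_one_filter_neq_bot]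
      show "0 \<le> snorm \<one>\<^bsub>L\<^esub>" by simp
    qed
  next
    fix x
    assume "x \<in> carrier L"
    then show "snorm (inv\<^bsub>L\<^esub> x) = snorm x"
      by (intro seq_norm_eq_if_norms_eq)
        (auto simp: linear_growth_inv_nth norm_inv linear_growth_nth_closed)
  next
    fix x y
    assume xy: "x \<in> carrier L" "y \<in> carrier L"
    have "eventually (\<lambda>n. N ((x \<otimes>\<^bsub>L\<^esub> y) n) / real n \<le> N (x n) / real n + N (y n) / real n) U"
      using eventually_U_ge_1
    proof eventually_elim
      case (elim n)
      then have "N ((x \<otimes>\<^bsub>L\<^esub> y) n) \<le> N (x n) + N (y n)"
        using xy by (simp add: linear_growth_mult_nth norm_mult_le linear_growth_nth_closed)
      then show ?case
        by (simp add: add_divide_distrib[symmetric] divide_right_mono)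
    qed
    moreover have "((\<lambda>n. N ((x \<otimes>\<^bsub>L\<^esub> y) n) / real n) \<longlongrightarrow> snorm (x \<otimes>\<^bsub>L\<^esub> y)) U"
      using xy by (intro tendsto_seq_norm) simp
    moreover have "((\<lambda>n. N (x n) / real n + N (y n) / real n) \<longlongrightarrow> snorm x + snorm y) U"
      using xy by (intro tendsto_add tendsto_seq_norm)
    ultimately show "snorm (x \<otimes>\<^bsub>L\<^esub> y) \<le> snorm x + snorm y"
      by (intro tendsto_le[OF measure_one_filter_neq_bot])
    show "snorm (x \<otimes>\<^bsub>L\<^esub> y \<otimes>\<^bsub>L\<^esub> inv\<^bsub>L\<^esub> x) = snorm y"
      using xy by (intro seq_norm_eq_if_norms_eq)
        (auto simp: linear_growth_mult_nth linear_growth_inv_nth linear_growth_nth_closed norm_conj)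
  qed
qed

text \<open>
  With \<open>G\<close> replaced by the group of sequences, the results on invariant norms describe the null
  sequences and the norm on their cosets.
\<close>

sublocale seq: invariant_norm L snorm
  by (rule seq_norm_invariant_norm)

lemma null_sequences_normal: "null_sequences G N \<omega> \<lhd> L"
  unfolding null_sequences_def by (rule seq.null_elements_normal)

lemma cone_dist_cosets:
  assumes "x \<in> carrier L" "y \<in> carrier L"
  shows "cone_dist G N \<omega> (null_sequences G N \<omega> #>\<^bsub>L\<^esub> x) (null_sequences G N \<omega> #>\<^bsub>L\<^esub> y)
    = snorm (x \<otimes>\<^bsub>L\<^esub> inv\<^bsub>L\<^esub> y)"
proof -
  interpret K: normal "null_sequences G N \<omega>" L
    by (rule null_sequences_normal)
  have "null_sequences G N \<omega> #>\<^bsub>L\<^esub> y \<in> carrier (L Mod null_sequences G N \<omega>)"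
    using assms by (auto simp: FactGroup_def RCOSETS_def)
  then have "inv\<^bsub>cone\<^esub> (null_sequences G N \<omega> #>\<^bsub>L\<^esub> y) = null_sequences G N \<omega> #>\<^bsub>L\<^esub> inv\<^bsub>L\<^esub> y"
    using assms by (simp add: asymptotic_cone_def K.inv_FactGroup K.rcos_inv)
  then have "(null_sequences G N \<omega> #>\<^bsub>L\<^esub> x) \<otimes>\<^bsub>cone\<^esub> inv\<^bsub>cone\<^esub> (null_sequences G N \<omega> #>\<^bsub>L\<^esub> y)
      = null_sequences G N \<omega> #>\<^bsub>L\<^esub> (x \<otimes>\<^bsub>L\<^esub> inv\<^bsub>L\<^esub> y)"
    using assms by (simp add: asymptotic_cone_def K.rcos_sum)
  moreover have "snorm ` (null_sequences G N \<omega> #>\<^bsub>L\<^esub> (x \<otimes>\<^bsub>L\<^esub> inv\<^bsub>L\<^esub> y))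
      = {snorm (x \<otimes>\<^bsub>L\<^esub> inv\<^bsub>L\<^esub> y)}"
    unfolding null_sequences_def using assms
    by (intro seq.norm_image_null_coset seq.m_closed seq.inv_closed)
  ultimately show ?thesis
    by (simp only: cone_dist_def norm_dist_def cone_norm_def the_elem_eq)
qed

lemma cone_eta_closed:
  assumes "g \<in> carrier G"
  shows "cone_eta G N \<omega> g \<in> carrier cone"
  using seq.rcosetsI[OF _ power_sequence_linear_growth[OF assms]]
    normal_imp_subgroup[OF null_sequences_normal, THEN subgroup.subset]
  by (simp only: cone_eta_def cone_class_def asymptotic_cone_def FactGroup_def partial_object.select_convs)

lemma cone_eta_one: "cone_eta G N \<omega> \<one> = \<one>\<^bsub>cone\<^esub>"
proof -
  have "null_sequences G N \<omega> \<subseteq> carrier L"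
    by (auto simp only: null_sequences_def)
  then have "null_sequences G N \<omega> #>\<^bsub>L\<^esub> \<one>\<^bsub>L\<^esub> = null_sequences G N \<omega>"
    by (rule seq.coset_mult_one)
  then show ?thesis
    by (simp only: cone_eta_def cone_class_def power_sequence_one asymptotic_cone_def
        FactGroup_def monoid.select_convs)
qed

lemma cone_eta_1_Lipschitz:
  assumes "g \<in> carrier G" "h \<in> carrier G"
  shows "cone_dist G N \<omega> (cone_eta G N \<omega> g) (cone_eta G N \<omega> h) \<le> N (g \<otimes> inv h)"
proof -
  let ?x = "\<lambda>n\<in>{1..}. g [^] (n::nat)" and ?y = "\<lambda>n\<in>{1..}. h [^] (n::nat)"
  have x: "?x \<in> carrier L" and y: "?y \<in> carrier L"
    by (rule power_sequence_linear_growth[OF assms(1)], rule power_sequence_linear_growth[OF assms(2)])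
  have "snorm (?x \<otimes>\<^bsub>L\<^esub> inv\<^bsub>L\<^esub> ?y) \<le> N (g \<otimes> inv h)"
  proof (rule seq_norm_le)
    fix n :: nat
    assume n: "1 \<le> n"
    have "(?x \<otimes>\<^bsub>L\<^esub> inv\<^bsub>L\<^esub> ?y) n = ?x n \<otimes> inv (?y n)"
      by (simp only: linear_growth_mult_nth[OF n] linear_growth_inv_nth[OF y n])
    also have "\<dots> = g [^] n \<otimes> inv (h [^] n)"
      using n by simp
    finally show "N ((?x \<otimes>\<^bsub>L\<^esub> inv\<^bsub>L\<^esub> ?y) n) \<le> real n * N (g \<otimes> inv h)"
      using norm_dist_pow_le[OF assms, of n] by (simp only:)
  qed (intro seq.m_closed seq.inv_closed x y)
  then show ?thesis
    by (simp only: cone_eta_def cone_class_def cone_dist_cosets[OF x y])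
qed

lemma partial_quasimorphism_comp_cone_eta:
  assumes "Lipschitz_fun (carrier cone) (cone_dist G N \<omega>) F" and F_one: "F \<one>\<^bsub>cone\<^esub> = 0"
  shows "partial_quasimorphism G N (F \<circ> cone_eta G N \<omega>)"
proof -
  obtain C where C: "C > 0"
    and F: "\<And>x y. x \<in> carrier cone \<Longrightarrow> y \<in> carrier cone \<Longrightarrow> \<bar>F x - F y\<bar> \<le> C * cone_dist G N \<omega> x y"
    using assms(1) unfolding Lipschitz_fun_def by blast
  define f where "f = F \<circ> cone_eta G N \<omega>"
  have lip: "\<bar>f g - f h\<bar> \<le> C * N (g \<otimes> inv h)" if "g \<in> carrier G" "h \<in> carrier G" for g h
  proof -
    have "\<bar>f g - f h\<bar> \<le> C * cone_dist G N \<omega> (cone_eta G N \<omega> g) (cone_eta G N \<omega> h)"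
      using that unfolding f_def by (simp add: F cone_eta_closed)
    also have "\<dots> \<le> C * N (g \<otimes> inv h)"
      using that C by (intro mult_left_mono cone_eta_1_Lipschitz) auto
    finally show ?thesis .
  qed
  have f_one: "f \<one> = 0"
    by (simp add: f_def cone_eta_one F_one)
  have f_le: "\<bar>f g\<bar> \<le> C * N g" if "g \<in> carrier G" for g
    using lip[OF that one_closed] that by (simp add: f_one)
  have "\<bar>f g - f (g \<otimes> h) + f h\<bar> \<le> 2 * C * min (N g) (N h)"
    if gh: "g \<in> carrier G" "h \<in> carrier G" for g h
  proof -
    have "\<bar>f g - f (g \<otimes> h)\<bar> \<le> C * N h" "\<bar>f h - f (g \<otimes> h)\<bar> \<le> C * N g"
      using lip[of g "g \<otimes> h"] lip[of h "g \<otimes> h"] gh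
      by (simp_all add: norm_dist_mult_right norm_dist_mult_left)
    with f_le[OF gh(1)] f_le[OF gh(2)] show ?thesis
      by (cases "N g \<le> N h"; simp add: min_def; linarith)
  qed
  then show ?thesis
    using C unfolding partial_quasimorphism_def f_def by (intro exI[of _ "2 * C"]) auto
qed

end

theorem proposition1p14:
  fixes G :: "('a, 'b) monoid_scheme"
    and S :: "'a set"
    and \<omega> :: "nat set \<Rightarrow> nat"
    and F :: "(nat \<Rightarrow> 'a) set \<Rightarrow> real"
  assumes "group G"
    and "symmetric_generating_set G S"
    and "bi_invariant G (norm_dist G (word_norm G S))"
    and "ultrafilter_measure \<omega>"
    and "nonprincipal \<omega>"
    and "Lipschitz_fun (carrier (asymptotic_cone G (word_norm G S) \<omega>))
           (cone_dist G (word_norm G S) \<omega>) F"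
    and "F \<one>\<^bsub>asymptotic_cone G (word_norm G S) \<omega>\<^esub> = 0"
  shows "partial_quasimorphism G (word_norm G S) (F \<circ> cone_eta G (word_norm G S) \<omega>)"
proof -
  have "invariant_norm G (word_norm G S)"
    using assms(1-3) by (rule group.word_norm_invariant_norm)
  moreover have "nonprincipal_ultrafilter \<omega>"
    using assms(4,5) by (rule nonprincipal_ultrafilter.intro)
  ultimately interpret invariant_norm_ultrafilter G "word_norm G S" \<omega>
    by (rule invariant_norm_ultrafilter.intro)
  show ?thesis
    using assms(6,7) by (rule partial_quasimorphism_comp_cone_eta)
qed

end
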